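(* Let $R$ be an associative ring with unity. The following statements are equivalent: (1) $R$ is symmetric. (2) For all $a,b,c\in R$, $abc\in R^{\sharp}$ implies $acb\in R^{\sharp}$.
   Context: A ring $R$ is symmetric if, for all $a,b,c\in R$, $abc=0$ implies $acb=0$. An element $a\in R$ is group invertible if there is $x\in R$ with $axa=a$, $xax=x$ and $ax=xa$; such $x$ is unique and is denoted $a^{\sharp}$. $R^{\sharp}$ denotes the set of all group invertible elements of $R$. *)

theory Defs
  imports "HOL-Algebra.Ring"
begin

text \<open>The locale \<^locale>\<open>ring\<close> is that of associative, not necessarily commutative rings
  with unity; the zero ring is included. The predicates below are meant for such structures.\<close>

definition symmetric_ring :: "('a, 'm) ring_scheme \<Rightarrow> bool" where
  "symmetric_ring R \<longleftrightarrow>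
    (\<forall>a\<in>carrier R. \<forall>b\<in>carrier R. \<forall>c\<in>carrier R.
      a \<otimes>\<^bsub>R\<^esub> b \<otimes>\<^bsub>R\<^esub> c = \<zero>\<^bsub>R\<^esub> \<longrightarrow> a \<otimes>\<^bsub>R\<^esub> c \<otimes>\<^bsub>R\<^esub> b = \<zero>\<^bsub>R\<^esub>)"

definition group_inverse :: "('a, 'm) ring_scheme \<Rightarrow> 'a \<Rightarrow> 'a \<Rightarrow> bool" where
  "group_inverse R a x \<longleftrightarrow>
    a \<otimes>\<^bsub>R\<^esub> x \<otimes>\<^bsub>R\<^esub> a = a \<and> x \<otimes>\<^bsub>R\<^esub> a \<otimes>\<^bsub>R\<^esub> x = x \<and> a \<otimes>\<^bsub>R\<^esub> x = x \<otimes>\<^bsub>R\<^esub> a"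

definition group_invertibles :: "('a, 'm) ring_scheme \<Rightarrow> 'a set" where
  "group_invertibles R = {a \<in> carrier R. \<exists>x\<in>carrier R. group_inverse R a x}"

end

theory Submission
  imports Defs "HOL-Algebra.Multiplicative_Group"
begin

text \<open>Both directions rest on the fact that symmetric rings, and also rings satisfying the second
  condition, are reversible (\<open>a b = 0\<close> implies \<open>b a = 0\<close>) and hence have only central idempotents.
  In the second case reversibility holds because \<open>b c = 0\<close> makes \<open>c b\<close> both group invertible and
  square zero.

  A group invertible element \<open>w\<close> with group inverse \<open>x\<close> is a unit of the corner ring \<open>e R\<close>, where
  \<open>e = w x\<close> is idempotent. When idempotents are central, a one-sided inverse in \<open>e R\<close> is two-sided
  (\<open>corner_right_inverse_imp_left\<close>). So if \<open>w\<close> is a product of three elements, all three factors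
  become units of \<open>e R\<close>, and their product in any other order is again a unit of \<open>e R\<close>.

  In a symmetric ring, \<open>a b c (1 - e) = 0\<close> gives \<open>a c b (1 - e) = 0\<close>; thus \<open>a c b\<close> lies in
  \<open>e R\<close> and is a unit there, which means that it is group invertible. Conversely, if \<open>a b c = 0\<close>,
  then \<open>a c b\<close> is group invertible, and for its idempotent \<open>e\<close> the factors \<open>a\<close> and \<open>c\<close> can be
  cancelled from \<open>a b c = 0\<close> inside \<open>e R\<close>. This leaves \<open>b e = 0\<close> and so \<open>a c b = a c b e = 0\<close>.\<close>

definition reversible_ring :: "('a, 'm) ring_scheme \<Rightarrow> bool" where
  "reversible_ring R \<longleftrightarrow>
    (\<forall>a\<in>carrier R. \<forall>b\<in>carrier R. a \<otimes>\<^bsub>R\<^esub> b = \<zero>\<^bsub>R\<^esub> \<longrightarrow> b \<otimes>\<^bsub>R\<^esub> a = \<zero>\<^bsub>R\<^esub>)"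

definition central_idempotents :: "('a, 'm) ring_scheme \<Rightarrow> bool" where
  "central_idempotents R \<longleftrightarrow>
    (\<forall>e\<in>carrier R. e \<otimes>\<^bsub>R\<^esub> e = e \<longrightarrow> (\<forall>r\<in>carrier R. e \<otimes>\<^bsub>R\<^esub> r = r \<otimes>\<^bsub>R\<^esub> e))"

context ring
begin

lemma minus_l_distr:
  "\<lbrakk>a \<in> carrier R; b \<in> carrier R; c \<in> carrier R\<rbrakk> \<Longrightarrow> (a \<ominus> b) \<otimes> c = a \<otimes> c \<ominus> b \<otimes> c"
  by (simp add: minus_eq l_distr l_minus)

lemma minus_r_distr:
  "\<lbrakk>a \<in> carrier R; b \<in> carrier R; c \<in> carrier R\<rbrakk> \<Longrightarrow> c \<otimes> (a \<ominus> b) = c \<otimes> a \<ominus> c \<otimes> b"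
  by (simp add: minus_eq r_distr r_minus)

text \<open>Both \<open>e (r - e r)\<close> and \<open>(r - r e) e\<close> vanish; reversing these products turns them into
  \<open>r e = e r e\<close> and \<open>e r = e r e\<close>.\<close>
lemma reversible_imp_central_idempotents:
  assumes "reversible_ring R"
  shows "central_idempotents R"
  unfolding central_idempotents_def
proof (intro ballI impI)
  fix e r
  assume e: "e \<in> carrier R" "e \<otimes> e = e" and r: "r \<in> carrier R"
  have ee: "e \<otimes> (e \<otimes> r) = e \<otimes> r"
    using e r by (simp flip: m_assoc)
  have "e \<otimes> (r \<ominus> e \<otimes> r) = \<zero>"
    using e r ee by (simp add: minus_r_distr)
  then have "(r \<ominus> e \<otimes> r) \<otimes> e = \<zero>"
    using assms e r by (simp add: reversible_ring_def)
  then have 1: "r \<otimes> e = e \<otimes> r \<otimes> e"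
    using e r by (simp add: minus_l_distr)
  have "(r \<ominus> r \<otimes> e) \<otimes> e = \<zero>"
    using e r by (simp add: minus_l_distr m_assoc)
  then have "e \<otimes> (r \<ominus> r \<otimes> e) = \<zero>"
    using assms e r by (simp add: reversible_ring_def)
  then have 2: "e \<otimes> r = e \<otimes> (r \<otimes> e)"
    using e r by (simp add: minus_r_distr)
  show "e \<otimes> r = r \<otimes> e"
    using 1 2 e r by (simp add: m_assoc)
qed

lemma symmetric_imp_reversible:
  assumes "symmetric_ring R"
  shows "reversible_ring R"
  using assms unfolding symmetric_ring_def reversible_ring_def
  by (metis one_closed l_one)

text \<open>This is Dedekind finiteness of the corner ring \<open>e R\<close>: there \<open>f = q p e\<close> is idempotent, hence
  central, so that it can be pulled out of \<open>e = p q p q = p f q = f p q = f\<close>.\<close>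
lemma corner_right_inverse_imp_left:
  assumes central: "central_idempotents R"
    and carr: "p \<in> carrier R" "q \<in> carrier R" "e \<in> carrier R"
    and idem: "e \<otimes> e = e" and pq: "p \<otimes> q = e"
  shows "q \<otimes> p \<otimes> e = e"
proof -
  have ec: "e \<otimes> r = r \<otimes> e" if "r \<in> carrier R" for r
    using central carr idem that unfolding central_idempotents_def by blast
  define f where "f = q \<otimes> p \<otimes> e"
  have f: "f \<in> carrier R"
    using carr by (simp add: f_def)
  have "f \<otimes> f = q \<otimes> p \<otimes> (e \<otimes> (q \<otimes> p)) \<otimes> e"
    using carr by (simp add: f_def m_assoc)
  also have "\<dots> = q \<otimes> (p \<otimes> q) \<otimes> p \<otimes> (e \<otimes> e)"
    using carr ec[of "q \<otimes> p"] by (simp add: m_assoc)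
  also have "\<dots> = q \<otimes> (e \<otimes> p) \<otimes> e"
    using carr by (simp only: pq idem m_assoc m_closed)
  also have "\<dots> = q \<otimes> p \<otimes> (e \<otimes> e)"
    using carr by (simp add: ec[of p] m_assoc)
  also have "\<dots> = f"
    by (simp add: f_def idem)
  finally have "f \<otimes> r = r \<otimes> f" if "r \<in> carrier R" for r
    using central f that unfolding central_idempotents_def by blast
  then have fc: "f \<otimes> p = p \<otimes> f"
    using carr by blast
  have "f = f \<otimes> e"
    using carr by (simp add: f_def m_assoc idem)
  also have "\<dots> = (f \<otimes> p) \<otimes> q"
    using carr f by (simp add: m_assoc flip: pq)
  also have "\<dots> = p \<otimes> (q \<otimes> p \<otimes> e) \<otimes> q"
    by (simp only: fc) (simp add: f_def)
  also have "\<dots> = (p \<otimes> q) \<otimes> p \<otimes> (e \<otimes> q)"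
    using carr by (simp add: m_assoc)
  also have "\<dots> = (p \<otimes> q) \<otimes> (p \<otimes> q) \<otimes> e"
    using carr by (simp only: ec[of q] m_assoc m_closed)
  also have "\<dots> = e"
    by (simp add: pq idem)
  finally show ?thesis
    by (simp add: f_def)
qed

text \<open>The condition \<open>w e = w\<close> places \<open>w\<close> in the corner ring \<open>e R\<close>, whose units are group
  invertible: the group inverse of \<open>w\<close> in \<open>R\<close> is \<open>y e\<close>, the right inverse cut down to the corner.\<close>
lemma corner_right_invertible_imp_group_invertible:
  assumes central: "central_idempotents R"
    and carr: "w \<in> carrier R" "y \<in> carrier R" "e \<in> carrier R"
    and idem: "e \<otimes> e = e" and we: "w \<otimes> e = w" and wy: "w \<otimes> y = e"
  shows "w \<in> group_invertibles R"
proof -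
  have ec: "e \<otimes> r = r \<otimes> e" if "r \<in> carrier R" for r
    using central carr idem that unfolding central_idempotents_def by blast
  have ywe: "y \<otimes> w \<otimes> e = e"
    using corner_right_inverse_imp_left[OF central carr idem wy] .
  have right: "w \<otimes> (y \<otimes> e) = e"
    using carr wy idem by (simp flip: m_assoc)
  have left: "y \<otimes> e \<otimes> w = e"
    using carr ywe by (simp add: m_assoc ec[of w])
  have "w \<otimes> (y \<otimes> e) \<otimes> w = w"
    using carr we by (simp add: right ec)
  moreover have "y \<otimes> e \<otimes> w \<otimes> (y \<otimes> e) = y \<otimes> e"
    using carr idem ec[of "y \<otimes> e"] by (simp add: left m_assoc)
  ultimately show ?thesis
    using carr left right
    by (auto simp: group_invertibles_def group_inverse_def intro!: bexI[of _ "y \<otimes> e"])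
qed

lemma group_invertible_idempotent:
  assumes "w \<in> group_invertibles R"
  obtains x e where "x \<in> carrier R" "e \<in> carrier R" "e \<otimes> e = e"
    "w \<otimes> x = e" "w \<otimes> e = w"
proof -
  obtain x where x: "w \<in> carrier R" "x \<in> carrier R" "w \<otimes> x \<otimes> w = w"
      "w \<otimes> x = x \<otimes> w"
    using assms by (auto simp: group_invertibles_def group_inverse_def)
  have "w \<otimes> x \<otimes> (w \<otimes> x) = w \<otimes> x"
    using x(1-3) by (simp flip: m_assoc)
  moreover have "w \<otimes> (w \<otimes> x) = w"
    using x by (metis m_assoc)
  ultimately show ?thesis
    using that[of x "w \<otimes> x"] x by simp
qed

lemma group_invertible_square_zero:
  assumes "w \<in> group_invertibles R" "w \<otimes> w = \<zero>"
  shows "w = \<zero>"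
proof -
  obtain x where x: "w \<in> carrier R" "x \<in> carrier R" "w \<otimes> x \<otimes> w = w"
      "w \<otimes> x = x \<otimes> w"
    using assms by (auto simp: group_invertibles_def group_inverse_def)
  then have "w = x \<otimes> (w \<otimes> w)"
    by (simp add: m_assoc)
  then show ?thesis
    using assms x by simp
qed

text \<open>Inside \<open>e R\<close> the equation \<open>a d = e\<close> is also \<open>d a = e\<close>, so a factorization of \<open>e\<close> may be
  rotated. This is how every factor of a unit of \<open>e R\<close> acquires a right inverse.\<close>
lemma corner_rotate:
  assumes "central_idempotents R"
    and "a \<in> carrier R" "b \<in> carrier R" "d \<in> carrier R" "e \<in> carrier R"
    and "e \<otimes> e = e" and "a \<otimes> (b \<otimes> d) = e"
  shows "b \<otimes> (d \<otimes> a \<otimes> e) = e"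
  using corner_right_inverse_imp_left[of a "b \<otimes> d" e] assms by (simp add: m_assoc)

lemma symmetric_imp_group_invertible_swap:
  assumes sym: "symmetric_ring R"
    and carr: "a \<in> carrier R" "b \<in> carrier R" "c \<in> carrier R"
    and gi: "a \<otimes> b \<otimes> c \<in> group_invertibles R"
  shows "a \<otimes> c \<otimes> b \<in> group_invertibles R"
proof -
  have central: "central_idempotents R"
    using sym symmetric_imp_reversible reversible_imp_central_idempotents by blast
  obtain x e where x: "x \<in> carrier R" "e \<in> carrier R" and idem: "e \<otimes> e = e"
    and wx: "a \<otimes> b \<otimes> c \<otimes> x = e" and we: "a \<otimes> b \<otimes> c \<otimes> e = a \<otimes> b \<otimes> c"
    using group_invertible_idempotent[OF gi] by metis
  have ec: "e \<otimes> r = r \<otimes> e" if "r \<in> carrier R" for r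
    using central x idem that unfolding central_idempotents_def by blast
  define b' where "b' = c \<otimes> x \<otimes> a \<otimes> e"
  define c' where "c' = x \<otimes> a \<otimes> e \<otimes> b \<otimes> e"
  define a' where "a' = b \<otimes> c \<otimes> x"
  have carr': "a' \<in> carrier R" "b' \<in> carrier R" "c' \<in> carrier R"
    using carr x by (simp_all add: a'_def b'_def c'_def)
  have aa: "a \<otimes> a' = e"
    using wx carr x by (simp add: a'_def m_assoc)
  have bb: "b \<otimes> b' = e"
    using corner_rotate[of a b "c \<otimes> x" e] central aa carr x idem by (simp add: a'_def b'_def m_assoc)
  have cc: "c \<otimes> c' = e"
    using corner_rotate[of b c "x \<otimes> a \<otimes> e" e] central bb carr x idem
    by (simp add: c'_def b'_def m_assoc)
  have "a \<otimes> c \<otimes> b \<otimes> (b' \<otimes> c' \<otimes> a') = a \<otimes> (c \<otimes> ((b \<otimes> b') \<otimes> (c' \<otimes> a')))"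
    using carr carr' by (simp add: m_assoc)
  also have "\<dots> = a \<otimes> ((c \<otimes> c') \<otimes> (a' \<otimes> e))"
    using carr carr' x bb by (simp add: ec[of "c' \<otimes> a'"] m_assoc)
  also have "\<dots> = (a \<otimes> a') \<otimes> (e \<otimes> e)"
    using carr carr' x cc by (simp add: ec[of "a' \<otimes> e"] m_assoc)
  finally have inv: "a \<otimes> c \<otimes> b \<otimes> (b' \<otimes> c' \<otimes> a') = e"
    by (simp add: aa idem)
  have "a \<otimes> b \<otimes> (c \<ominus> c \<otimes> e) = \<zero>"
    using we carr x by (simp add: minus_r_distr flip: m_assoc)
  then have "a \<otimes> (c \<ominus> c \<otimes> e) \<otimes> b = \<zero>"
    using sym carr x by (simp add: symmetric_ring_def)
  then have "a \<otimes> c \<otimes> b = a \<otimes> (c \<otimes> e) \<otimes> b"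
    using carr x by (simp add: minus_l_distr minus_r_distr)
  then have "a \<otimes> c \<otimes> b \<otimes> e = a \<otimes> c \<otimes> b"
    using carr x by (simp add: m_assoc ec[of b] idem)
  then show ?thesis
    using corner_right_invertible_imp_group_invertible[OF central _ _ _ idem _ inv]
      carr carr' x by simp
qed

lemma zero_group_invertible: "\<zero> \<in> group_invertibles R"
  by (auto simp: group_invertibles_def group_inverse_def intro!: bexI[of _ \<zero>])

text \<open>Taking \<open>a = 1\<close> in the hypothesis, \<open>b c = 0\<close> makes \<open>c b\<close> group invertible, while
  \<open>(c b)\<^sup>2 = c (b c) b = 0\<close>.\<close>
lemma group_invertible_swap_imp_reversible:
  assumes swap: "\<And>a b c. \<lbrakk>a \<in> carrier R; b \<in> carrier R; c \<in> carrier R;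
      a \<otimes> b \<otimes> c \<in> group_invertibles R\<rbrakk> \<Longrightarrow> a \<otimes> c \<otimes> b \<in> group_invertibles R"
  shows "reversible_ring R"
  unfolding reversible_ring_def
proof (intro ballI impI)
  fix b c
  assume bc: "b \<in> carrier R" "c \<in> carrier R" "b \<otimes> c = \<zero>"
  have "c \<otimes> b \<in> group_invertibles R"
    using swap[of \<one> b c] bc zero_group_invertible by simp
  moreover have "c \<otimes> b \<otimes> (c \<otimes> b) = c \<otimes> (b \<otimes> c) \<otimes> b"
    using bc(1,2) by (simp add: m_assoc)
  then have "c \<otimes> b \<otimes> (c \<otimes> b) = \<zero>"
    using bc by simp
  ultimately show "c \<otimes> b = \<zero>"
    using group_invertible_square_zero by blast
qed

lemma group_invertible_swap_imp_symmetric: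
  assumes swap: "\<And>a b c. \<lbrakk>a \<in> carrier R; b \<in> carrier R; c \<in> carrier R;
      a \<otimes> b \<otimes> c \<in> group_invertibles R\<rbrakk> \<Longrightarrow> a \<otimes> c \<otimes> b \<in> group_invertibles R"
  shows "symmetric_ring R"
  unfolding symmetric_ring_def
proof (intro ballI impI)
  fix a b c
  assume carr: "a \<in> carrier R" "b \<in> carrier R" "c \<in> carrier R"
    and abc: "a \<otimes> b \<otimes> c = \<zero>"
  have central: "central_idempotents R"
    using reversible_imp_central_idempotents group_invertible_swap_imp_reversible swap by blast
  have "a \<otimes> c \<otimes> b \<in> group_invertibles R"
    using swap[OF carr] abc zero_group_invertible by simp
  then obtain x e where x: "x \<in> carrier R" "e \<in> carrier R" and idem: "e \<otimes> e = e"
    and wx: "a \<otimes> c \<otimes> b \<otimes> x = e" and we: "a \<otimes> c \<otimes> b \<otimes> e = a \<otimes> c \<otimes> b"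
    using group_invertible_idempotent by metis
  have ec: "e \<otimes> r = r \<otimes> e" if "r \<in> carrier R" for r
    using central x idem that unfolding central_idempotents_def by blast
  define a' where "a' = c \<otimes> b \<otimes> x"
  define c' where "c' = b \<otimes> x \<otimes> a \<otimes> e"
  have carr': "a' \<in> carrier R" "c' \<in> carrier R"
    using carr x by (simp_all add: a'_def c'_def)
  have aa: "a' \<otimes> a \<otimes> e = e"
    using corner_right_inverse_imp_left[of a a' e] central wx carr carr' x idem
    by (simp add: a'_def m_assoc)
  have cc: "c \<otimes> c' = e"
    using corner_rotate[of a c "b \<otimes> x" e] central wx carr x idem by (simp add: c'_def m_assoc)
  \<comment> \<open>Here \<open>a'\<close> cancels \<open>a\<close> from the left and \<open>c'\<close> cancels \<open>c\<close> from the right, up to factors \<open>e\<close>.\<close>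
  have "b \<otimes> e = b \<otimes> (e \<otimes> e)"
    by (simp add: idem)
  also have "\<dots> = (e \<otimes> b) \<otimes> e"
    using carr x by (simp add: ec[of b] m_assoc)
  also have "\<dots> = (a' \<otimes> a \<otimes> e) \<otimes> b \<otimes> (c \<otimes> c')"
    by (simp add: aa cc)
  also have "\<dots> = a' \<otimes> a \<otimes> (e \<otimes> (b \<otimes> c \<otimes> c'))"
    using carr carr' x by (simp add: m_assoc)
  also have "\<dots> = a' \<otimes> (a \<otimes> b \<otimes> c) \<otimes> c' \<otimes> e"
    using carr carr' x by (simp add: ec[of "b \<otimes> c \<otimes> c'"]) (simp add: m_assoc)
  also have "\<dots> = \<zero>"
    using carr' x by (simp add: abc)
  finally have "b \<otimes> e = \<zero>" .
  then show "a \<otimes> c \<otimes> b = \<zero>"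
    using we carr x by (simp add: m_assoc)
qed

end

theorem theorem3p3:
  fixes R :: "('a, 'm) ring_scheme"
  assumes "ring R"
  shows "symmetric_ring R \<longleftrightarrow>
    (\<forall>a\<in>carrier R. \<forall>b\<in>carrier R. \<forall>c\<in>carrier R.
      a \<otimes>\<^bsub>R\<^esub> b \<otimes>\<^bsub>R\<^esub> c \<in> group_invertibles R \<longrightarrow>
      a \<otimes>\<^bsub>R\<^esub> c \<otimes>\<^bsub>R\<^esub> b \<in> group_invertibles R)"
proof -
  interpret ring R
    by fact
  show ?thesis
    using symmetric_imp_group_invertible_swap group_invertible_swap_imp_symmetric by blast
qed

end
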